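(* Let $R$ be a $d\times d$ expansive integer matrix, let $B\subset\mathbb{Z}^d$ with $\#B=N\ge 2$, let $L\subset\mathbb{R}^d$ with $\#L=N$, and suppose $(B,L)$ is a Hadamard pair. Define $$\Pi(B)=\{\gamma\in\mathbb{R}^d:\gamma\cdot b\in\mathbb{Z}\text{ for all }b\in B\}.$$ If $\mu$ is a spectral measure on $\mathbb{R}^d$ with spectrum $\Lambda$ contained in $\Pi(B)$, then $\mathcal{T}\mu$ is a spectral measure with spectrum $\mathcal{S}\Lambda$.
   Context: A matrix is expansive if all its eigenvalues have modulus greater than $1$. $(B,L)$ is a Hadamard pair if the $N\times N$ matrix $\frac{1}{\sqrt N}\left(e^{2\pi i R^{-1}b\cdot l}\right)_{b\in B,l\in L}$ is unitary. For $b\in B$, $\tau_b(x)=R^{-1}(x+b)$ on $\mathbb{R}^d$. For a Borel probability measure $\mu$ on $\mathbb{R}^d$, $\mathcal{T}\mu$ is the Borel probability measure $(\mathcal{T}\mu)(E)=\frac1N\sum_{b\in B}\mu(\tau_b^{-1}(E))$. For $\Lambda\subset\mathbb{R}^d$, $\mathcal{S}\Lambda=\bigcup_{l\in L}(R^T\Lambda+l)$. With $e_\lambda(x)=e^{2\pi i\lambda\cdot x}$, a Borel probability measure $\mu$ on $\mathbb{R}^d$ is spectral with spectrum $\Lambda\subset\mathbb{R}^d$ if the family $(e_\lambda)_{\lambda\in\Lambda}$ is an orthonormal basis of $L^2(\mu)$. *)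

theory Defs
  imports "HOL-Probability.Probability"
begin

definition integer_matrix :: "real ^ 'n::finite ^ 'n \<Rightarrow> bool" where
  "integer_matrix R \<longleftrightarrow> (\<forall>i j. R $ i $ j \<in> \<int>)"

definition integer_lattice :: "(real ^ 'n::finite) set" where
  "integer_lattice = {x. \<forall>i. x $ i \<in> \<int>}"

definition eigenvalue_of :: "complex ^ 'n::finite ^ 'n \<Rightarrow> complex \<Rightarrow> bool" where
  "eigenvalue_of A z \<longleftrightarrow> (\<exists>v. v \<noteq> 0 \<and> A *v v = z *s v)"

text \<open>The eigenvalues of a real matrix are its complex eigenvalues.\<close>

definition expansive :: "real ^ 'n::finite ^ 'n \<Rightarrow> bool" where
  "expansive R \<longleftrightarrow> (\<forall>z. eigenvalue_of (map_matrix complex_of_real R) z \<longrightarrow> 1 < cmod z)"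

text \<open>Unitarity, with rows indexed by I and columns by J: \<open>U U\<^sup>* = 1\<close> and \<open>U\<^sup>* U = 1\<close>.\<close>

definition unitary_on :: "'a set \<Rightarrow> 'b set \<Rightarrow> ('a \<Rightarrow> 'b \<Rightarrow> complex) \<Rightarrow> bool" where
  "unitary_on I J U \<longleftrightarrow>
     (\<forall>i\<in>I. \<forall>i'\<in>I. (\<Sum>j\<in>J. U i j * cnj (U i' j)) = (if i = i' then 1 else 0)) \<and>
     (\<forall>j\<in>J. \<forall>j'\<in>J. (\<Sum>i\<in>I. cnj (U i j) * U i j') = (if j = j' then 1 else 0))"

definition Hadamard_pair ::
  "real ^ 'n::finite ^ 'n \<Rightarrow> (real ^ 'n) set \<Rightarrow> (real ^ 'n) set \<Rightarrow> bool" where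
  "Hadamard_pair R B L \<longleftrightarrow> finite B \<and> finite L \<and> card B = card L \<and>
     unitary_on B L (\<lambda>b l. complex_of_real (1 / sqrt (real (card B))) *
       exp (2 * complex_of_real pi * \<i> * complex_of_real ((matrix_inv R *v b) \<bullet> l)))"

definition tau :: "real ^ 'n::finite ^ 'n \<Rightarrow> real ^ 'n \<Rightarrow> real ^ 'n \<Rightarrow> real ^ 'n" where
  "tau R b x = matrix_inv R *v (x + b)"

definition T_op ::
  "real ^ 'n::finite ^ 'n \<Rightarrow> (real ^ 'n) set \<Rightarrow> (real ^ 'n) measure \<Rightarrow> (real ^ 'n) measure" where
  "T_op R B \<mu> = measure_of UNIV (sets borel)
     (\<lambda>E. ennreal (1 / real (card B)) * (\<Sum>b\<in>B. emeasure \<mu> (tau R b -` E)))"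

definition S_op ::
  "real ^ 'n::finite ^ 'n \<Rightarrow> (real ^ 'n) set \<Rightarrow> (real ^ 'n) set \<Rightarrow> (real ^ 'n) set" where
  "S_op R L \<Lambda> = (\<Union>l\<in>L. (\<lambda>x. transpose R *v x + l) ` \<Lambda>)"

definition Pi_dual :: "(real ^ 'n::finite) set \<Rightarrow> (real ^ 'n) set" where
  "Pi_dual B = {\<gamma>. \<forall>b\<in>B. \<gamma> \<bullet> b \<in> \<int>}"

definition char_exp :: "real ^ 'n::finite \<Rightarrow> real ^ 'n \<Rightarrow> complex" where
  "char_exp \<xi> x = exp (2 * complex_of_real pi * \<i> * complex_of_real (\<xi> \<bullet> x))"

definition L2 :: "'a measure \<Rightarrow> ('a \<Rightarrow> complex) set" where
  "L2 M = {f \<in> borel_measurable M. integrable M (\<lambda>x. (cmod (f x))\<^sup>2)}"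

definition L2_inner :: "'a measure \<Rightarrow> ('a \<Rightarrow> complex) \<Rightarrow> ('a \<Rightarrow> complex) \<Rightarrow> complex" where
  "L2_inner M f g = (LINT x|M. f x * cnj (g x))"

definition L2_dist :: "'a measure \<Rightarrow> ('a \<Rightarrow> complex) \<Rightarrow> ('a \<Rightarrow> complex) \<Rightarrow> real" where
  "L2_dist M f g = sqrt (LINT x|M. (cmod (f x - g x))\<^sup>2)"

text \<open>Functions represent their classes modulo equality almost everywhere. An orthonormal basis
  is an orthonormal family, indexed by I, whose finite linear combinations are dense in
  \<open>L\<^sup>2(M)\<close>. Orthonormality is required for distinct indices, so
  no two members of the family may agree almost everywhere.\<close>

definition orthonormal_basis_L2 :: "'a measure \<Rightarrow> 'i set \<Rightarrow> ('i \<Rightarrow> 'a \<Rightarrow> complex) \<Rightarrow> bool" where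
  "orthonormal_basis_L2 M I e \<longleftrightarrow>
     (\<forall>i\<in>I. e i \<in> L2 M) \<and>
     (\<forall>i\<in>I. \<forall>j\<in>I. L2_inner M (e i) (e j) = (if i = j then 1 else 0)) \<and>
     (\<forall>f\<in>L2 M. \<forall>\<epsilon>>0. \<exists>F c. finite F \<and> F \<subseteq> I \<and>
        L2_dist M f (\<lambda>x. \<Sum>i\<in>F. c i * e i x) < \<epsilon>)"

definition borel_prob_measure :: "'a::topological_space measure \<Rightarrow> bool" where
  "borel_prob_measure \<mu> \<longleftrightarrow> prob_space \<mu> \<and> sets \<mu> = sets borel"

definition spectral_with :: "(real ^ 'n::finite) measure \<Rightarrow> (real ^ 'n) set \<Rightarrow> bool" where
  "spectral_with \<mu> \<Lambda> \<longleftrightarrow> borel_prob_measure \<mu> \<and> orthonormal_basis_L2 \<mu> \<Lambda> char_exp"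

text \<open>An expansive matrix is invertible, so \<open>matrix_inv R\<close> is a genuine inverse.\<close>

lemma expansive_invertible:
  assumes "expansive R"
  shows "invertible R"
proof (rule ccontr)
  assume "\<not> invertible R"
  then obtain x where x: "R *v x = 0" "x \<noteq> 0"
    using invertible_left_inverse matrix_left_invertible_ker by metis
  define v where "v = (\<chi> i. complex_of_real (x $ i))"
  have "(map_matrix complex_of_real R *v v) $ i = complex_of_real ((R *v x) $ i)" for i
    by (simp add: matrix_vector_mult_def v_def)
  then have "map_matrix complex_of_real R *v v = 0 *s v"
    using x by (simp add: vec_eq_iff)
  moreover have "v \<noteq> 0"
    using x by (auto simp: v_def vec_eq_iff)
  ultimately have "eigenvalue_of (map_matrix complex_of_real R) 0"
    unfolding eigenvalue_of_def by blast
  with assms show False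
    unfolding expansive_def by force
qed

text \<open>The set function in the definition of \<open>T_op\<close> is a measure, so \<open>measure_of\<close> does not
  degenerate.\<close>

lemma tau_vimage_borel:
  fixes R :: "real ^ 'n::finite ^ 'n"
  assumes "E \<in> sets borel"
  shows "tau R b -` E \<in> sets borel"
proof -
  have "tau R b \<in> borel_measurable borel"
    unfolding tau_def
    by (intro borel_measurable_continuous_onI continuous_intros
          linear_continuous_on_compose[where f = "\<lambda>x. x + b"]) auto
  from measurable_sets[OF this assms] show ?thesis by simp
qed

lemma emeasure_T_op:
  fixes R :: "real ^ 'n::finite ^ 'n"
  assumes \<mu>: "sets \<mu> = sets borel" and "E \<in> sets borel"
  shows "emeasure (T_op R B \<mu>) E =
    ennreal (1 / real (card B)) * (\<Sum>b\<in>B. emeasure \<mu> (tau R b -` E))"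
proof (rule emeasure_measure_of[OF T_op_def])
  let ?m = "\<lambda>E. ennreal (1 / real (card B)) * (\<Sum>b\<in>B. emeasure \<mu> (tau R b -` E))"
  show "countably_additive (sets (T_op R B \<mu>)) ?m"
  proof (rule countably_additiveI)
    fix A :: "nat \<Rightarrow> (real ^ 'n) set"
    assume A: "range A \<subseteq> sets (T_op R B \<mu>)" "disjoint_family A"
    have s: "sets (T_op R B \<mu>) = sets borel"
      unfolding T_op_def by (metis sets.sigma_sets_eq sets_measure_of space_borel sets.space_closed)
    have "(\<Sum>i. emeasure \<mu> (tau R b -` A i)) = emeasure \<mu> (tau R b -` (\<Union>i. A i))" for b
      unfolding vimage_UN
    proof (rule suminf_emeasure)
      show "range (\<lambda>i. tau R b -` A i) \<subseteq> sets \<mu>"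
        using A s \<mu> by (auto simp: image_subset_iff intro!: tau_vimage_borel)
      show "disjoint_family (\<lambda>i. tau R b -` A i)"
        using A by (fastforce simp: disjoint_family_on_def)
    qed
    then show "(\<Sum>i. ?m (A i)) = ?m (\<Union>i. A i)"
      by (simp add: suminf_sum[OF summableI] ennreal_suminf_cmult)
  qed
qed (use assms in \<open>auto simp: positive_def T_op_def sets.sigma_sets_eq[of borel, simplified]\<close>)

end

theory Submission
  imports Defs
begin

text \<open>By \<open>integral_T_op\<close> the map \<open>f \<mapsto> (f \<circ> \<tau>\<^sub>b)\<close>, indexed by \<open>b \<in> B\<close>, sends \<open>L\<^sup>2(T\<mu>)\<close>
  to \<open>N\<close> copies of \<open>L\<^sup>2(\<mu>)\<close> and scales norms by \<open>\<surd>N\<close>, so the claim can be checked on tuples of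
  functions in \<open>L\<^sup>2(\<mu>)\<close>. Write \<open>W b l\<close> for \<open>e\<^sub>l(R\<^sup>-\<^sup>1 b)\<close>, which is \<open>\<surd>N\<close> times an entry
  of the unitary Hadamard matrix. Since \<open>\<gamma> \<cdot> b\<close> is an integer for \<open>\<gamma> \<in> \<Lambda>\<close>, the exponential with
  frequency \<open>R\<^sup>T \<gamma> + l\<close> composed with \<open>\<tau>\<^sub>b\<close> splits as

    \<open>W b l \<cdot> e\<^sub>l(R\<^sup>-\<^sup>1 x) \<cdot> e\<^sub>\<gamma>(x)\<close>,

  and \<open>b\<close> occurs only in the first factor (\<open>char_exp_tau\<close>).

  For orthonormality, the sum over \<open>b\<close> of the products of first factors is \<open>0\<close> for distinct
  \<open>l\<close> by unitarity; for equal \<open>l\<close> the middle factors cancel, and the orthonormality of the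
  \<open>e\<^sub>\<gamma>\<close> in \<open>L\<^sup>2(\<mu>)\<close> remains (\<open>L2_inner_T_op_char_exp\<close>). This also shows that
  \<open>(l, \<gamma>) \<mapsto> R\<^sup>T \<gamma> + l\<close> is injective on \<open>L \<times> \<Lambda>\<close> (\<open>inj_on_S_op\<close>).

  For density (\<open>S_op_char_exp_dense\<close>), let \<open>f\<close> be in \<open>L\<^sup>2(T\<mu>)\<close>. Inverting the Hadamard matrix
  pointwise gives functions \<open>g l\<close> in \<open>L\<^sup>2(\<mu>)\<close> such that \<open>f(\<tau>\<^sub>b x)\<close> is the sum over \<open>l\<close> of
  \<open>W b l \<cdot> e\<^sub>l(R\<^sup>-\<^sup>1 x) \<cdot> g l x\<close> for all \<open>b\<close>. If each \<open>g l\<close> is replaced by a linear combination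
  \<open>h l\<close> of the \<open>e\<^sub>\<gamma>\<close>, these sums become \<open>G(\<tau>\<^sub>b x)\<close> for one linear combination \<open>G\<close> of the
  new exponentials. By unitarity (\<open>Hadamard_pair_Parseval\<close>) the squared distance from \<open>f\<close> to
  \<open>G\<close> is the sum over \<open>l\<close> of the squared distances from \<open>g l\<close> to \<open>h l\<close>, and these can be made
  arbitrarily small because the \<open>e\<^sub>\<gamma>\<close> span a dense subspace of \<open>L\<^sup>2(\<mu>)\<close>.\<close>

section \<open>Integration with respect to the averaged measure\<close>

lemma tau_measurable [measurable]: "tau R b \<in> borel_measurable borel"
  by (rule measurableI) (use tau_vimage_borel in auto)

lemma char_exp_measurable [measurable]: "char_exp \<xi> \<in> borel_measurable borel"
  unfolding char_exp_def by measurable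

lemma cnj_measurable [measurable]: "cnj \<in> borel_measurable borel"
  by (intro borel_measurable_continuous_onI continuous_intros)

lemma matrix_vector_mult_measurable [measurable]:
  fixes A :: "real ^ 'n::finite ^ 'm::finite"
  shows "(*v) A \<in> borel_measurable borel"
  by (intro borel_measurable_continuous_onI linear_continuous_on) auto

lemma sets_T_op [simp, measurable_cong]: "sets (T_op R B \<mu>) = sets borel"
  unfolding T_op_def by (metis sets.sigma_sets_eq sets_measure_of space_borel sets.space_closed)

lemma space_T_op [simp]: "space (T_op R B \<mu>) = UNIV"
  using sets_eq_imp_space_eq[OF sets_T_op] by auto

lemma measurable_T_op [simp]: "measurable (T_op R B \<mu>) M = measurable borel M"
  by (rule measurable_cong_sets) simp_all

lemma nn_integral_T_op:
  fixes R :: "real ^ 'n::finite ^ 'n"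
  assumes sets_\<mu>: "sets \<mu> = sets borel" and "f \<in> borel_measurable borel"
  shows "(\<integral>\<^sup>+x. f x \<partial>T_op R B \<mu>) =
    ennreal (1 / real (card B)) * (\<Sum>b\<in>B. \<integral>\<^sup>+x. f (tau R b x) \<partial>\<mu>)"
proof -
  note [measurable_cong] = sets_\<mu>
  have "f \<in> borel_measurable (T_op R B \<mu>)"
    using assms(2) by simp
  then show ?thesis
  proof (induction rule: borel_measurable_induct)
    case (cong f g)
    then show ?case by (simp add: fun_eq_iff)
  next
    case (set A)
    have "(\<integral>\<^sup>+x. indicator A (tau R b x) \<partial>\<mu>) = emeasure \<mu> (tau R b -` A)" for b
    proof -
      have "(\<integral>\<^sup>+x. indicator A (tau R b x) \<partial>\<mu>) = (\<integral>\<^sup>+x. indicator (tau R b -` A) x \<partial>\<mu>)"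
        by (simp add: indicator_def)
      then show ?thesis
        using set tau_vimage_borel[of A R b] sets_\<mu> by simp
    qed
    then show ?case
      using set by (simp add: emeasure_T_op[OF sets_\<mu>])
  next
    case (mult u c)
    from mult(2) have [measurable]: "u \<in> borel_measurable borel" by simp
    show ?case
      using mult by (simp add: nn_integral_cmult sum_distrib_left[symmetric] mult.left_commute)
  next
    case (add u v)
    from add(1,3) have [measurable]: "u \<in> borel_measurable borel" "v \<in> borel_measurable borel"
      by simp_all
    show ?case
      using add by (simp add: nn_integral_add sum.distrib distrib_left)
  next
    case (seq U)
    have [measurable]: "U i \<in> borel_measurable borel" for i using seq(1)[of i] by simp
    have "(\<integral>\<^sup>+x. (SUP i. U i) x \<partial>T_op R B \<mu>) = (SUP i. \<integral>\<^sup>+x. U i x \<partial>T_op R B \<mu>)"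
      using nn_integral_monotone_convergence_SUP[OF \<open>incseq U\<close>, of "T_op R B \<mu>"]
      by (simp add: image_comp)
    also have "\<dots> = (SUP i. ennreal (1 / real (card B)) * (\<Sum>b\<in>B. \<integral>\<^sup>+x. U i (tau R b x) \<partial>\<mu>))"
      using seq by simp
    also have "\<dots> = ennreal (1 / real (card B)) *
        (\<Sum>b\<in>B. SUP i. \<integral>\<^sup>+x. U i (tau R b x) \<partial>\<mu>)"
    proof -
      have inc: "incseq (\<lambda>i. \<integral>\<^sup>+x. U i (tau R b x) \<partial>\<mu>)" for b
        using \<open>incseq U\<close> by (auto simp: incseq_def le_fun_def intro!: nn_integral_mono)
      show ?thesis
        by (simp only: SUP_mult_left_ennreal[symmetric] ennreal_SUP_sum[OF inc])
    qed
    also have "(\<Sum>b\<in>B. SUP i. \<integral>\<^sup>+x. U i (tau R b x) \<partial>\<mu>) =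
        (\<Sum>b\<in>B. \<integral>\<^sup>+x. (SUP i. U i) (tau R b x) \<partial>\<mu>)"
    proof (rule sum.cong[OF refl])
      fix b
      have "incseq (\<lambda>i x. U i (tau R b x))"
        using \<open>incseq U\<close> by (auto simp: incseq_def le_fun_def)
      from nn_integral_monotone_convergence_SUP[OF this, of \<mu>]
      show "(SUP i. \<integral>\<^sup>+x. U i (tau R b x) \<partial>\<mu>) = (\<integral>\<^sup>+x. (SUP i. U i) (tau R b x) \<partial>\<mu>)"
        by (simp add: image_comp)
    qed
    finally show ?case .
  qed
qed

lemma borel_prob_measure_T_op:
  fixes R :: "real ^ 'n::finite ^ 'n"
  assumes "borel_prob_measure \<mu>" and "finite B" and "B \<noteq> {}"
  shows "borel_prob_measure (T_op R B \<mu>)"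
proof -
  interpret \<mu>: prob_space \<mu> using assms by (simp add: borel_prob_measure_def)
  have sets_\<mu>: "sets \<mu> = sets borel" using assms by (simp add: borel_prob_measure_def)
  then have "space \<mu> = UNIV" using sets_eq_imp_space_eq by fastforce
  then have "emeasure \<mu> UNIV = 1" using \<mu>.emeasure_space_1 by simp
  then have "emeasure (T_op R B \<mu>) UNIV = ennreal (1 / real (card B)) * of_nat (card B)"
    by (simp add: emeasure_T_op[OF sets_\<mu>])
  also have "\<dots> = ennreal (1 / real (card B) * real (card B))"
    by (simp add: ennreal_of_nat_eq_real_of_nat flip: ennreal_mult)
  also have "\<dots> = 1" using assms by simp
  finally show ?thesis
    by (auto simp: borel_prob_measure_def intro!: prob_spaceI)
qed

lemma integrable_T_op_iff:
  fixes R :: "real ^ 'n::finite ^ 'n" and f :: "real ^ 'n \<Rightarrow> 'b::{banach, second_countable_topology}"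
  assumes sets_\<mu>: "sets \<mu> = sets borel" and fin: "finite B" "B \<noteq> {}"
    and [measurable]: "f \<in> borel_measurable borel"
  shows "integrable (T_op R B \<mu>) f \<longleftrightarrow> (\<forall>b\<in>B. integrable \<mu> (\<lambda>x. f (tau R b x)))"
proof -
  note [measurable_cong] = sets_\<mu>
  have "(\<integral>\<^sup>+x. norm (f x) \<partial>T_op R B \<mu>) < \<infinity> \<longleftrightarrow>
      (\<forall>b\<in>B. (\<integral>\<^sup>+x. norm (f (tau R b x)) \<partial>\<mu>) < \<infinity>)"
    using fin by (auto simp: nn_integral_T_op[OF sets_\<mu>] ennreal_mult_less_top
        ennreal_zero_less_divide less_top ennreal_sum_less_top)
  then show ?thesis
    by (simp add: integrable_iff_bounded)
qed

text \<open>Both sides are linear in \<open>f\<close> and, by dominated convergence, continuous along the simple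
  functions that approximate \<open>f\<close>, so the case of an indicator function suffices.\<close>

lemma integral_T_op:
  fixes R :: "real ^ 'n::finite ^ 'n" and f :: "real ^ 'n \<Rightarrow> 'b::{banach, second_countable_topology}"
  assumes sets_\<mu>: "sets \<mu> = sets borel" and fin: "finite B" "B \<noteq> {}"
    and "integrable (T_op R B \<mu>) f"
  shows "(LINT x|T_op R B \<mu>. f x) = (\<Sum>b\<in>B. LINT x|\<mu>. f (tau R b x)) /\<^sub>R real (card B)"
proof -
  note [measurable_cong] = sets_\<mu>
  have int: "integrable \<mu> (\<lambda>x. g (tau R b x))"
    if "integrable (T_op R B \<mu>) g" "b \<in> B" for g :: "real ^ 'n \<Rightarrow> 'b" and b
  proof -
    have "g \<in> borel_measurable borel"
      using borel_measurable_integrable[OF that(1)] by simp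
    then show ?thesis
      using that integrable_T_op_iff[OF sets_\<mu> fin] by blast
  qed
  from assms(4) show ?thesis
  proof (induction rule: integrable_induct)
    case (base A c)
    have vimage: "tau R b -` A \<in> sets \<mu>" for b
      using base tau_vimage_borel sets_\<mu> by auto
    have fin_b: "emeasure \<mu> (tau R b -` A) < \<infinity>" if "b \<in> B" for b
      using base fin that by (auto simp: emeasure_T_op[OF sets_\<mu>] ennreal_mult_less_top
        ennreal_zero_less_divide less_top ennreal_sum_less_top)
    have "emeasure (T_op R B \<mu>) A = ennreal ((\<Sum>b\<in>B. measure \<mu> (tau R b -` A)) / real (card B))"
    proof -
      have "emeasure (T_op R B \<mu>) A =
          ennreal (1 / real (card B)) * (\<Sum>b\<in>B. ennreal (measure \<mu> (tau R b -` A)))"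
        unfolding emeasure_T_op[OF sets_\<mu> base(1)[simplified]] using fin_b
        by (intro arg_cong2[where f="(*)"] sum.cong refl emeasure_eq_ennreal_measure)
          (auto simp: less_top)
      then show ?thesis
        by (simp add: sum_ennreal sum_nonneg flip: ennreal_mult)
    qed
    then have m: "measure (T_op R B \<mu>) A = (\<Sum>b\<in>B. measure \<mu> (tau R b -` A)) / real (card B)"
      by (simp add: measure_def sum_nonneg)
    have "(LINT x|\<mu>. indicator A (tau R b x) *\<^sub>R c) = measure \<mu> (tau R b -` A) *\<^sub>R c"
      if "b \<in> B" for b
    proof -
      have "(LINT x|\<mu>. indicator A (tau R b x) *\<^sub>R c) =
          (LINT x|\<mu>. indicator (tau R b -` A) x *\<^sub>R c)"
        by (simp add: indicator_def)
      then show ?thesis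
        using vimage[of b] fin_b[OF that] by (simp add: less_top)
    qed
    then show ?case
      using base m by (simp add: less_top scaleR_sum_left[symmetric] divide_inverse mult.commute)
  next
    case (add f g)
    then show ?case
      by (simp add: int sum.distrib scaleR_right_distrib)
  next
    case (lim f s)
    have [measurable]: "f \<in> borel_measurable borel" "s i \<in> borel_measurable borel" for i
      using borel_measurable_integrable[OF lim(1)] borel_measurable_integrable[OF lim(4)] by simp_all
    have "(\<lambda>i. LINT x|T_op R B \<mu>. s i x) \<longlonglongrightarrow> (LINT x|T_op R B \<mu>. f x)"
      by (rule integral_dominated_convergence[where w="\<lambda>x. 2 * norm (f x)"]) (use lim in auto)
    moreover have "(\<lambda>i. LINT x|\<mu>. s i (tau R b x)) \<longlonglongrightarrow> (LINT x|\<mu>. f (tau R b x))" if "b \<in> B" for b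
      by (rule integral_dominated_convergence[where w="\<lambda>x. 2 * norm (f (tau R b x))"])
        (use lim int[OF lim(4) that] in auto)
    then have "(\<lambda>i. (\<Sum>b\<in>B. LINT x|\<mu>. s i (tau R b x)) /\<^sub>R real (card B))
        \<longlonglongrightarrow> (\<Sum>b\<in>B. LINT x|\<mu>. f (tau R b x)) /\<^sub>R real (card B)"
      by (intro tendsto_intros) auto
    ultimately show ?case
      using lim(5) LIMSEQ_unique by simp
  qed
qed

section \<open>Square-integrable functions\<close>

lemma L2_diff:
  assumes "f \<in> L2 M" and "g \<in> L2 M"
  shows "(\<lambda>x. f x - g x) \<in> L2 M"
proof -
  have [measurable]: "f \<in> borel_measurable M" "g \<in> borel_measurable M"
    using assms by (auto simp: L2_def)
  have "integrable M (\<lambda>x. (cmod (f x - g x))\<^sup>2)"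
  proof (rule Bochner_Integration.integrable_bound)
    show "integrable M (\<lambda>x. 2 * (cmod (f x))\<^sup>2 + 2 * (cmod (g x))\<^sup>2)"
      using assms by (auto simp: L2_def)
    have "(cmod (f x - g x))\<^sup>2 \<le> 2 * (cmod (f x))\<^sup>2 + 2 * (cmod (g x))\<^sup>2" for x
    proof -
      have "(cmod (f x - g x))\<^sup>2 \<le> (cmod (f x) + cmod (g x))\<^sup>2"
        by (simp add: norm_triangle_ineq4 power_mono)
      also have "\<dots> \<le> 2 * (cmod (f x))\<^sup>2 + 2 * (cmod (g x))\<^sup>2"
        using zero_le_power2[of "cmod (f x) - cmod (g x)"] by (simp add: power2_sum power2_diff)
      finally show ?thesis .
    qed
    then show "AE x in M. norm ((cmod (f x - g x))\<^sup>2) \<le>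
        norm (2 * (cmod (f x))\<^sup>2 + 2 * (cmod (g x))\<^sup>2)"
      by simp
  qed measurable
  then show ?thesis by (simp add: L2_def)
qed

lemma (in finite_measure) L2_bounded:
  assumes [measurable]: "f \<in> borel_measurable M" and "\<And>x. cmod (f x) \<le> C"
  shows "f \<in> L2 M"
proof -
  have "integrable M (\<lambda>x. (cmod (f x))\<^sup>2)"
    by (rule integrable_const_bound[where B="C\<^sup>2"]) (use assms in \<open>auto intro!: AE_I2 power_mono\<close>)
  then show ?thesis by (simp add: L2_def)
qed

lemma cmod_char_exp [simp]: "cmod (char_exp \<xi> x) = 1"
  by (simp add: char_exp_def norm_exp_eq_Re)

lemma char_exp_mult_cnj [simp]: "char_exp \<xi> x * cnj (char_exp \<xi> x) = 1"
  by (simp add: complex_norm_square[symmetric])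

lemma char_exp_sum_L2:
  assumes "borel_prob_measure \<mu>"
  shows "(\<lambda>x. \<Sum>\<xi>\<in>F. c \<xi> * char_exp \<xi> x) \<in> L2 \<mu>"
proof -
  interpret prob_space \<mu> using assms by (simp add: borel_prob_measure_def)
  have [measurable_cong]: "sets \<mu> = sets borel"
    using assms by (simp add: borel_prob_measure_def)
  have "cmod (\<Sum>\<xi>\<in>F. c \<xi> * char_exp \<xi> x) \<le> (\<Sum>\<xi>\<in>F. cmod (c \<xi>))" for x
    by (rule sum_norm_le) (simp add: norm_mult)
  then show ?thesis
    by (intro L2_bounded) measurable
qed

section \<open>The Hadamard matrix\<close>

text \<open>The exponent expands to four inner products. The one of \<open>\<gamma>\<close> with \<open>b\<close> is an integer, so its
  exponential is 1; here the frequency \<open>\<gamma>\<close> has to lie in \<open>Pi_dual B\<close>.\<close>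

lemma char_exp_tau:
  fixes R :: "real ^ 'n::finite ^ 'n"
  assumes "invertible R" and "\<gamma> \<in> Pi_dual B" and "b \<in> B"
  shows "char_exp (transpose R *v \<gamma> + l) (tau R b x) =
    char_exp l (matrix_inv R *v b) * (char_exp l (matrix_inv R *v x) * char_exp \<gamma> x)"
proof -
  have "(transpose R *v \<gamma>) \<bullet> (matrix_inv R *v (x + b)) = \<gamma> \<bullet> (R *v (matrix_inv R *v (x + b)))"
    by (metis dot_lmul_matrix transpose_matrix_vector)
  also have "R *v (matrix_inv R *v (x + b)) = x + b"
  proof -
    have "R ** matrix_inv R = mat 1"
      using assms(1) unfolding invertible_def matrix_inv_def by (rule someI2_ex) simp
    then show ?thesis by (simp add: matrix_vector_mul_assoc)
  qed
  finally have eq: "(transpose R *v \<gamma> + l) \<bullet> tau R b x =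
      (l \<bullet> (matrix_inv R *v b) + (l \<bullet> (matrix_inv R *v x) + \<gamma> \<bullet> x)) + \<gamma> \<bullet> b"
    by (simp add: tau_def inner_add_left inner_add_right matrix_vector_right_distrib)
  from assms obtain k where k: "\<gamma> \<bullet> b = of_int k"
    by (auto simp: Pi_dual_def elim: Ints_cases)
  have "exp (2 * complex_of_real pi * \<i> * of_int k) = 1"
    by (metis exp_2pi_1_int mult.commute mult.left_commute)
  then show ?thesis
    unfolding char_exp_def eq k by (simp only: of_real_add of_real_of_int_eq distrib_left exp_add
        mult_1_right)
qed

lemma Hadamard_pair_unitary:
  assumes "Hadamard_pair R B L"
  shows "unitary_on B L (\<lambda>b l. complex_of_real (1 / sqrt (real (card B))) *
    char_exp l (matrix_inv R *v b))"
proof -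
  have "char_exp l x = exp (2 * complex_of_real pi * \<i> * complex_of_real (x \<bullet> l))"
    for l x :: "real ^ 'a"
    by (simp add: char_exp_def inner_commute)
  note eq = this
  show ?thesis
    using assms unfolding Hadamard_pair_def eq by blast
qed

text \<open>Unitarity of the normalized matrix, with the factors \<open>1/\<surd>N\<close> cleared.\<close>

lemma Hadamard_pair_rows:
  assumes "Hadamard_pair R B L" and "b \<in> B" and "b' \<in> B"
  shows "(\<Sum>l\<in>L. char_exp l (matrix_inv R *v b) * cnj (char_exp l (matrix_inv R *v b'))) =
    (if b = b' then of_nat (card B) else 0)"
proof -
  let ?W = "\<lambda>b l. char_exp l (matrix_inv R *v b)" and ?s = "complex_of_real (1 / sqrt (real (card B)))"
  have N: "card B \<noteq> 0" using assms by (auto simp: Hadamard_pair_def)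
  have s: "?s * ?s = 1 / of_nat (card B)"
    by (simp flip: of_real_mult)
  have "(if b = b' then 1 else 0) = (\<Sum>l\<in>L. (?s * ?W b l) * cnj (?s * ?W b' l))"
    using Hadamard_pair_unitary[OF assms(1)] assms by (simp only: unitary_on_def)
  also have "\<dots> = (?s * ?s) * (\<Sum>l\<in>L. ?W b l * cnj (?W b' l))"
    by (simp add: sum_distrib_left mult_ac)
  finally show ?thesis
    unfolding s using N by (simp add: field_simps split: if_splits)
qed

lemma Hadamard_pair_columns:
  assumes "Hadamard_pair R B L" and "B \<noteq> {}" and "l \<in> L" and "l' \<in> L"
  shows "(\<Sum>b\<in>B. char_exp l (matrix_inv R *v b) * cnj (char_exp l' (matrix_inv R *v b))) =
    (if l = l' then of_nat (card B) else 0)"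
proof -
  let ?W = "\<lambda>b l. char_exp l (matrix_inv R *v b)" and ?s = "complex_of_real (1 / sqrt (real (card B)))"
  have N: "card B \<noteq> 0" using assms by (auto simp: Hadamard_pair_def)
  have s: "?s * ?s = 1 / of_nat (card B)"
    by (simp flip: of_real_mult)
  have "(if l' = l then 1 else 0) = (\<Sum>b\<in>B. cnj (?s * ?W b l') * (?s * ?W b l))"
    using Hadamard_pair_unitary[OF assms(1)] assms by (simp only: unitary_on_def)
  also have "\<dots> = (?s * ?s) * (\<Sum>b\<in>B. ?W b l * cnj (?W b l'))"
    by (simp add: sum_distrib_left mult_ac)
  finally show ?thesis
    unfolding s using N by (simp add: field_simps split: if_splits)
qed

text \<open>Parseval's identity: a matrix with orthogonal columns of squared norm \<open>N\<close> scales the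
  Euclidean norm by \<open>\<surd>N\<close>.\<close>

lemma Hadamard_pair_Parseval:
  assumes H: "Hadamard_pair R B L" and "B \<noteq> {}"
  shows "(\<Sum>b\<in>B. (cmod (\<Sum>l\<in>L. char_exp l (matrix_inv R *v b) * u l))\<^sup>2) =
    real (card B) * (\<Sum>l\<in>L. (cmod (u l))\<^sup>2)"
proof -
  let ?W = "\<lambda>b l. char_exp l (matrix_inv R *v b)"
  have fin: "finite L" using H by (simp add: Hadamard_pair_def)
  have "complex_of_real (\<Sum>b\<in>B. (cmod (\<Sum>l\<in>L. ?W b l * u l))\<^sup>2) =
      (\<Sum>b\<in>B. (\<Sum>l\<in>L. ?W b l * u l) * cnj (\<Sum>l\<in>L. ?W b l * u l))"
    by (simp only: complex_norm_square of_real_sum)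
  also have "\<dots> = (\<Sum>b\<in>B. \<Sum>l\<in>L. \<Sum>l'\<in>L. (u l * cnj (u l')) * (?W b l * cnj (?W b l')))"
    by (simp add: sum_product mult_ac)
  also have "\<dots> = (\<Sum>l\<in>L. \<Sum>b\<in>B. \<Sum>l'\<in>L. (u l * cnj (u l')) * (?W b l * cnj (?W b l')))"
    by (rule sum.swap)
  also have "\<dots> = (\<Sum>l\<in>L. \<Sum>l'\<in>L. \<Sum>b\<in>B. (u l * cnj (u l')) * (?W b l * cnj (?W b l')))"
    by (intro sum.cong refl sum.swap)
  also have "\<dots> = (\<Sum>l\<in>L. \<Sum>l'\<in>L. (u l * cnj (u l')) * (\<Sum>b\<in>B. ?W b l * cnj (?W b l')))"
    by (simp only: sum_distrib_left)
  also have "\<dots> = (\<Sum>l\<in>L. \<Sum>l'\<in>L. if l = l' then (u l * cnj (u l')) * of_nat (card B) else 0)"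
    using Hadamard_pair_columns[OF H assms(2)] by (auto intro!: sum.cong)
  also have "\<dots> = (\<Sum>l\<in>L. of_nat (card B) * complex_of_real ((cmod (u l))\<^sup>2))"
    using fin by (simp only: sum.delta complex_norm_square) (simp add: mult.commute sum.delta')
  also have "\<dots> = complex_of_real (real (card B) * (\<Sum>l\<in>L. (cmod (u l))\<^sup>2))"
    by (simp add: sum_distrib_left)
  finally show ?thesis
    by (simp only: of_real_eq_iff)
qed

section \<open>Orthonormality\<close>

text \<open>After \<open>char_exp_tau\<close> the integrands for the various \<open>b\<close> differ only by a constant factor, so
  the inner product is an integral over \<open>\<mu>\<close> times the inner product of two Hadamard columns.\<close>

lemma L2_inner_T_op_char_exp:
  fixes R :: "real ^ 'n::finite ^ 'n"
  assumes R: "invertible R" and H: "Hadamard_pair R B L" and "B \<noteq> {}"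
    and spec: "spectral_with \<mu> \<Lambda>" and "\<Lambda> \<subseteq> Pi_dual B"
    and mem: "\<gamma> \<in> \<Lambda>" "\<gamma>' \<in> \<Lambda>" "l \<in> L" "l' \<in> L"
  shows "L2_inner (T_op R B \<mu>)
      (char_exp (transpose R *v \<gamma> + l)) (char_exp (transpose R *v \<gamma>' + l')) =
    (if \<gamma> = \<gamma>' \<and> l = l' then 1 else 0)"
proof -
  have fin: "finite B" using H by (simp add: Hadamard_pair_def)
  have \<mu>: "borel_prob_measure \<mu>" and sets_\<mu>: "sets \<mu> = sets borel"
    using spec by (auto simp: spectral_with_def borel_prob_measure_def)
  interpret T: prob_space "T_op R B \<mu>"
    using borel_prob_measure_T_op[OF \<mu> fin \<open>B \<noteq> {}\<close>] by (simp add: borel_prob_measure_def)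
  let ?W = "\<lambda>b l. char_exp l (matrix_inv R *v b)"
  let ?e = "char_exp (transpose R *v \<gamma> + l)" and ?e' = "char_exp (transpose R *v \<gamma>' + l')"
  let ?h = "\<lambda>x. (?W x l * char_exp \<gamma> x) * cnj (?W x l' * char_exp \<gamma>' x)"
  have "integrable (T_op R B \<mu>) (\<lambda>x. ?e x * cnj (?e' x))"
    by (rule T.integrable_const_bound[where B=1]) (simp_all add: norm_mult)
  then have "L2_inner (T_op R B \<mu>) ?e ?e' =
      (\<Sum>b\<in>B. LINT x|\<mu>. ?e (tau R b x) * cnj (?e' (tau R b x))) /\<^sub>R real (card B)"
    unfolding L2_inner_def by (rule integral_T_op[OF sets_\<mu> fin \<open>B \<noteq> {}\<close>])
  also have "(\<Sum>b\<in>B. LINT x|\<mu>. ?e (tau R b x) * cnj (?e' (tau R b x))) =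
      (\<Sum>b\<in>B. LINT x|\<mu>. (?W b l * cnj (?W b l')) * ?h x)"
    using mem \<open>\<Lambda> \<subseteq> Pi_dual B\<close>
    by (intro sum.cong Bochner_Integration.integral_cong refl)
      (subst (1 2) char_exp_tau[OF R], auto simp: mult_ac)
  also have "\<dots> = (\<Sum>b\<in>B. ?W b l * cnj (?W b l')) * (LINT x|\<mu>. ?h x)"
    by (simp only: integral_mult_right_zero sum_distrib_right)
  also have "\<dots> = (if l = l' then of_nat (card B) * L2_inner \<mu> (char_exp \<gamma>) (char_exp \<gamma>') else 0)"
  proof -
    have "?h x = char_exp \<gamma> x * cnj (char_exp \<gamma>' x)" if "l = l'" for x
    proof -
      have "?h x = (?W x l * cnj (?W x l)) * (char_exp \<gamma> x * cnj (char_exp \<gamma>' x))"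
        using that by (simp add: mult_ac del: char_exp_mult_cnj)
      then show ?thesis by simp
    qed
    then have "(LINT x|\<mu>. ?h x) = L2_inner \<mu> (char_exp \<gamma>) (char_exp \<gamma>')" if "l = l'"
      unfolding L2_inner_def using that by (intro Bochner_Integration.integral_cong refl)
    then show ?thesis
      unfolding Hadamard_pair_columns[OF H \<open>B \<noteq> {}\<close> mem(3,4)] by auto
  qed
  also have "L2_inner \<mu> (char_exp \<gamma>) (char_exp \<gamma>') = (if \<gamma> = \<gamma>' then 1 else 0)"
    using spec mem by (simp add: spectral_with_def orthonormal_basis_L2_def)
  finally show ?thesis
    using fin \<open>B \<noteq> {}\<close> by (simp add: scaleR_conv_of_real)
qed

lemma inj_on_S_op:
  fixes R :: "real ^ 'n::finite ^ 'n"
  assumes "invertible R" "Hadamard_pair R B L" "B \<noteq> {}" "spectral_with \<mu> \<Lambda>" "\<Lambda> \<subseteq> Pi_dual B"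
  shows "inj_on (\<lambda>(l, \<gamma>). transpose R *v \<gamma> + l) (L \<times> \<Lambda>)"
proof (rule inj_onI, clarify)
  fix l \<gamma> l' \<gamma>'
  assume mem: "l \<in> L" "\<gamma> \<in> \<Lambda>" "l' \<in> L" "\<gamma>' \<in> \<Lambda>"
    and eq: "transpose R *v \<gamma> + l = transpose R *v \<gamma>' + l'"
  \<comment> \<open>Equal frequencies give the same exponential, whose inner product with itself is 1.\<close>
  show "l = l' \<and> \<gamma> = \<gamma>'"
    using L2_inner_T_op_char_exp[OF assms mem(2,2,1,1)]
      L2_inner_T_op_char_exp[OF assms mem(2,4,1,3)] eq
    by (auto split: if_splits)
qed

section \<open>Density of the new exponentials\<close>

text \<open>The tuple \<open>(f \<circ> \<tau>\<^sub>b)\<close> is approximated through its Hadamard coefficients \<open>g l\<close>, each of which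
  the given spectrum approximates in \<open>L\<^sup>2(\<mu>)\<close>.\<close>

lemma S_op_char_exp_dense:
  fixes R :: "real ^ 'n::finite ^ 'n"
  assumes R: "invertible R" and H: "Hadamard_pair R B L" and "B \<noteq> {}"
    and spec: "spectral_with \<mu> \<Lambda>" and \<Lambda>: "\<Lambda> \<subseteq> Pi_dual B"
    and f: "f \<in> L2 (T_op R B \<mu>)" and "\<epsilon> > 0"
  shows "\<exists>F c. finite F \<and> F \<subseteq> S_op R L \<Lambda> \<and>
    L2_dist (T_op R B \<mu>) f (\<lambda>x. \<Sum>\<xi>\<in>F. c \<xi> * char_exp \<xi> x) < \<epsilon>"
proof -
  have fin: "finite B" "finite L" and card_L: "card L = card B"
    using H by (auto simp: Hadamard_pair_def)
  define N where "N = real (card B)"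
  have N: "N > 0" using fin \<open>B \<noteq> {}\<close> by (auto simp: N_def card_gt_0_iff)
  have "L \<noteq> {}" using N card_L by (auto simp: N_def)
  have \<mu>: "borel_prob_measure \<mu>" and sets_\<mu>: "sets \<mu> = sets borel"
    using spec by (auto simp: spectral_with_def borel_prob_measure_def)
  note [measurable_cong] = sets_\<mu>
  let ?T = "T_op R B \<mu>"
  have T: "borel_prob_measure ?T"
    by (rule borel_prob_measure_T_op[OF \<mu> fin(1) \<open>B \<noteq> {}\<close>])
  have [measurable]: "f \<in> borel_measurable borel"
    using f by (simp add: L2_def)
  let ?W = "\<lambda>b l. char_exp l (matrix_inv R *v b)"

  define g where "g l x = cnj (?W x l) * ((\<Sum>b\<in>B. cnj (?W b l) * f (tau R b x)) / of_real N)" for l x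
  have W_g: "?W x l * g l x = (\<Sum>b\<in>B. cnj (?W b l) * f (tau R b x)) / of_real N" for l x
    unfolding g_def by (simp add: mult.assoc[symmetric])
  \<comment> \<open>The Hadamard matrix is inverted by its adjoint divided by N.\<close>
  have f_tau: "f (tau R b x) = (\<Sum>l\<in>L. ?W b l * (?W x l * g l x))" if "b \<in> B" for b x
  proof -
    have "(\<Sum>l\<in>L. ?W b l * (?W x l * g l x)) =
        (\<Sum>l\<in>L. \<Sum>b'\<in>B. (?W b l * cnj (?W b' l)) * (f (tau R b' x) / of_real N))"
      unfolding W_g by (simp add: sum_distrib_left sum_divide_distrib mult_ac)
    also have "\<dots> = (\<Sum>b'\<in>B. (\<Sum>l\<in>L. ?W b l * cnj (?W b' l)) * (f (tau R b' x) / of_real N))"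
      by (subst sum.swap) (simp only: sum_distrib_right)
    also have "\<dots> = (\<Sum>b'\<in>B. if b = b' then f (tau R b' x) else 0)"
      using N that by (intro sum.cong) (auto simp: Hadamard_pair_rows[OF H] N_def)
    also have "\<dots> = f (tau R b x)"
      using fin that by simp
    finally show ?thesis by simp
  qed
  have int_f: "integrable \<mu> (\<lambda>x. (cmod (f (tau R b x)))\<^sup>2)" if "b \<in> B" for b
    using f integrable_T_op_iff[OF sets_\<mu> fin(1) \<open>B \<noteq> {}\<close>, of "\<lambda>x. (cmod (f x))\<^sup>2" R] that
    by (simp add: L2_def)
  have g_L2: "g l \<in> L2 \<mu>" if "l \<in> L" for l
  proof -
    have [measurable]: "g l \<in> borel_measurable borel"
      unfolding g_def by measurable
    have "integrable \<mu> (\<lambda>x. (cmod (g l x))\<^sup>2)"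
    proof (rule Bochner_Integration.integrable_bound)
      show "integrable \<mu> (\<lambda>x. (\<Sum>b\<in>B. (cmod (f (tau R b x)))\<^sup>2) / N)"
        using int_f by simp
      have "(cmod (g l x))\<^sup>2 \<le> (\<Sum>b\<in>B. (cmod (f (tau R b x)))\<^sup>2) / N" for x
      proof -
        have "(\<Sum>b\<in>B. (cmod (f (tau R b x)))\<^sup>2) = N * (\<Sum>l\<in>L. (cmod (g l x))\<^sup>2)"
          using Hadamard_pair_Parseval[OF H \<open>B \<noteq> {}\<close>, of "\<lambda>l. ?W x l * g l x"]
          by (simp add: f_tau N_def norm_mult)
        then show ?thesis
          using N member_le_sum[of l L "\<lambda>l. (cmod (g l x))\<^sup>2"] fin that by simp
      qed
      then show "AE x in \<mu>. norm ((cmod (g l x))\<^sup>2) \<le> norm ((\<Sum>b\<in>B. (cmod (f (tau R b x)))\<^sup>2) / N)"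
        using N by (auto simp: sum_nonneg)
    qed measurable
    then show ?thesis by (simp add: L2_def)
  qed

  \<comment> \<open>The N squared errors, one for each l, have to add up to less than the square of \<open>\<epsilon>\<close>.\<close>
  define \<delta> where "\<delta> = \<epsilon> / sqrt N"
  have \<delta>: "\<delta> > 0" "N * \<delta>\<^sup>2 = \<epsilon>\<^sup>2"
    using N \<open>\<epsilon> > 0\<close> by (auto simp: \<delta>_def power_divide)
  define P where "P l F c \<longleftrightarrow> finite F \<and> F \<subseteq> \<Lambda> \<and>
    L2_dist \<mu> (g l) (\<lambda>x. \<Sum>\<gamma>\<in>F. c \<gamma> * char_exp \<gamma> x) < \<delta>" for l F c
  have "\<exists>F c. P l F c" if "l \<in> L" for l
    using spec g_L2[OF that] \<delta>(1) by (simp add: P_def spectral_with_def orthonormal_basis_L2_def)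
  then obtain F c where "\<And>l. l \<in> L \<Longrightarrow> P l (F l) (c l)"
    by metis
  then have F: "\<And>l. l \<in> L \<Longrightarrow> finite (F l)" "\<And>l. l \<in> L \<Longrightarrow> F l \<subseteq> \<Lambda>"
    and dist: "\<And>l. l \<in> L \<Longrightarrow> L2_dist \<mu> (g l) (\<lambda>x. \<Sum>\<gamma>\<in>F l. c l \<gamma> * char_exp \<gamma> x) < \<delta>"
    by (auto simp: P_def)
  define h where "h l x = (\<Sum>\<gamma>\<in>F l. c l \<gamma> * char_exp \<gamma> x)" for l x

  let ?\<phi> = "\<lambda>(l, \<gamma>). transpose R *v \<gamma> + l"
  define I where "I = (SIGMA l:L. F l)"
  have I: "I \<subseteq> L \<times> \<Lambda>" "finite I"
    using F fin by (auto simp: I_def)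
  have inj: "inj_on ?\<phi> (L \<times> \<Lambda>)"
    by (rule inj_on_S_op[OF R H \<open>B \<noteq> {}\<close> spec \<Lambda>])
  \<comment> \<open>Coefficients are indexed by the new frequencies, each of which determines its pair
    \<open>(l, \<gamma>)\<close>.\<close>
  define C where "C \<xi> = case_prod c (the_inv_into (L \<times> \<Lambda>) ?\<phi> \<xi>)" for \<xi>
  define G where "G x = (\<Sum>\<xi>\<in>?\<phi> ` I. C \<xi> * char_exp \<xi> x)" for x
  have G_tau: "G (tau R b x) = (\<Sum>l\<in>L. ?W b l * (?W x l * h l x))" if "b \<in> B" for b x
  proof -
    have "G (tau R b x) = (\<Sum>p\<in>I. C (?\<phi> p) * char_exp (?\<phi> p) (tau R b x))"
      unfolding G_def by (simp only: sum.reindex[OF inj_on_subset[OF inj I(1)]] o_def)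
    also have "\<dots> = (\<Sum>(l, \<gamma>)\<in>I. c l \<gamma> * (?W b l * (?W x l * char_exp \<gamma> x)))"
    proof (rule sum.cong[OF refl])
      fix p assume "p \<in> I"
      moreover obtain l \<gamma> where p: "p = (l, \<gamma>)" by (cases p)
      ultimately have "\<gamma> \<in> Pi_dual B" "(l, \<gamma>) \<in> L \<times> \<Lambda>"
        using I \<Lambda> by auto
      then show "C (?\<phi> p) * char_exp (?\<phi> p) (tau R b x) =
          (case p of (l, \<gamma>) \<Rightarrow> c l \<gamma> * (?W b l * (?W x l * char_exp \<gamma> x)))"
        using char_exp_tau[OF R _ that] the_inv_into_f_f[OF inj, of "(l, \<gamma>)"]
        by (simp add: p C_def)
    qed
    also have "\<dots> = (\<Sum>l\<in>L. \<Sum>\<gamma>\<in>F l. c l \<gamma> * (?W b l * (?W x l * char_exp \<gamma> x)))"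
      unfolding I_def using fin F by (subst sum.Sigma) auto
    finally show ?thesis
      by (simp add: h_def sum_distrib_left mult_ac)
  qed

  have "f (tau R b x) - G (tau R b x) = (\<Sum>l\<in>L. ?W b l * (?W x l * (g l x - h l x)))"
    if "b \<in> B" for b x
    by (simp only: f_tau[OF that] G_tau[OF that] right_diff_distrib sum_subtractf)
  then have Parseval: "(\<Sum>b\<in>B. (cmod (f (tau R b x) - G (tau R b x)))\<^sup>2) =
      N * (\<Sum>l\<in>L. (cmod (g l x - h l x))\<^sup>2)" for x
    using Hadamard_pair_Parseval[OF H \<open>B \<noteq> {}\<close>, of "\<lambda>l. ?W x l * (g l x - h l x)"]
    by (simp add: N_def norm_mult)
  have int_T: "integrable ?T (\<lambda>x. (cmod (f x - G x))\<^sup>2)"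
    using L2_diff[OF f char_exp_sum_L2[OF T]] unfolding G_def by (simp add: L2_def)
  have int_\<mu>: "integrable \<mu> (\<lambda>x. (cmod (g l x - h l x))\<^sup>2)" if "l \<in> L" for l
    using L2_diff[OF g_L2[OF that] char_exp_sum_L2[OF \<mu>]] unfolding h_def by (simp add: L2_def)
  have [measurable]: "G \<in> borel_measurable borel"
    unfolding G_def by measurable
  have int_b: "integrable \<mu> (\<lambda>x. (cmod (f (tau R b x) - G (tau R b x)))\<^sup>2)" if "b \<in> B" for b
    using int_T that integrable_T_op_iff[OF sets_\<mu> fin(1) \<open>B \<noteq> {}\<close>, of "\<lambda>x. (cmod (f x - G x))\<^sup>2" R]
    by simp
  have "(LINT x|?T. (cmod (f x - G x))\<^sup>2) =
      (\<Sum>b\<in>B. LINT x|\<mu>. (cmod (f (tau R b x) - G (tau R b x)))\<^sup>2) / N"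
    by (simp add: integral_T_op[OF sets_\<mu> fin(1) \<open>B \<noteq> {}\<close> int_T] N_def divide_inverse mult.commute)
  also have "\<dots> = (LINT x|\<mu>. (\<Sum>b\<in>B. (cmod (f (tau R b x) - G (tau R b x)))\<^sup>2)) / N"
    using int_b by (simp add: Bochner_Integration.integral_sum)
  also have "\<dots> = (\<Sum>l\<in>L. LINT x|\<mu>. (cmod (g l x - h l x))\<^sup>2)"
    unfolding Parseval using N int_\<mu> by (simp add: Bochner_Integration.integral_sum)
  also have "\<dots> < (\<Sum>l\<in>L. \<delta>\<^sup>2)"
  proof (rule sum_strict_mono[OF fin(2) \<open>L \<noteq> {}\<close>])
    fix l assume "l \<in> L"
    from dist[OF this] have "sqrt (LINT x|\<mu>. (cmod (g l x - h l x))\<^sup>2) < \<delta>"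
      by (simp add: L2_dist_def h_def)
    then show "(LINT x|\<mu>. (cmod (g l x - h l x))\<^sup>2) < \<delta>\<^sup>2"
      using \<delta>(1) real_sqrt_less_iff[of _ "\<delta>\<^sup>2"] by simp
  qed
  also have "\<dots> = \<epsilon>\<^sup>2"
    using \<delta>(2) card_L by (simp add: N_def)
  finally have "L2_dist ?T f G < \<epsilon>"
    using \<open>\<epsilon> > 0\<close> real_sqrt_less_iff[of _ "\<epsilon>\<^sup>2"] by (simp add: L2_dist_def)
  moreover have "?\<phi> ` I \<subseteq> S_op R L \<Lambda>"
    using I(1) by (force simp: S_op_def)
  ultimately show ?thesis
    using I(2) unfolding G_def by blast
qed

theorem proposition2p2:
  fixes R :: "real ^ 'd::finite ^ 'd"
    and B L \<Lambda> :: "(real ^ 'd) set"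
    and N :: nat
    and \<mu> :: "(real ^ 'd) measure"
  assumes "integer_matrix R" and "expansive R"
    and "B \<subseteq> integer_lattice" and "card B = N" and "N \<ge> 2"
    and "card L = N"
    and "Hadamard_pair R B L"
    and "spectral_with \<mu> \<Lambda>" and "\<Lambda> \<subseteq> Pi_dual B"
  shows "spectral_with (T_op R B \<mu>) (S_op R L \<Lambda>)"
proof -
  have R: "invertible R" by (rule expansive_invertible) fact
  have B: "finite B" "B \<noteq> {}"
    using assms by (auto simp: Hadamard_pair_def)
  have hyps: "invertible R" "Hadamard_pair R B L" "B \<noteq> {}" "spectral_with \<mu> \<Lambda>" "\<Lambda> \<subseteq> Pi_dual B"
    using assms R B by auto
  have T: "borel_prob_measure (T_op R B \<mu>)"
    using assms B by (intro borel_prob_measure_T_op) (auto simp: spectral_with_def)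
  have "char_exp \<xi> \<in> L2 (T_op R B \<mu>)" for \<xi>
    using char_exp_sum_L2[OF T, of "\<lambda>_. 1" "{\<xi>}"] by simp
  moreover have "L2_inner (T_op R B \<mu>) (char_exp \<xi>) (char_exp \<xi>') = (if \<xi> = \<xi>' then 1 else 0)"
    if mem: "\<xi> \<in> S_op R L \<Lambda>" "\<xi>' \<in> S_op R L \<Lambda>" for \<xi> \<xi>'
  proof -
    obtain \<gamma> l \<gamma>' l' where p: "\<gamma> \<in> \<Lambda>" "\<gamma>' \<in> \<Lambda>" "l \<in> L" "l' \<in> L"
      and \<xi>: "\<xi> = transpose R *v \<gamma> + l" "\<xi>' = transpose R *v \<gamma>' + l'"
      using mem by (auto simp: S_op_def)
    have "\<xi> = \<xi>' \<longleftrightarrow> \<gamma> = \<gamma>' \<and> l = l'"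
      using inj_on_eq_iff[OF inj_on_S_op[OF hyps], of "(l, \<gamma>)" "(l', \<gamma>')"] p \<xi> by auto
    then show ?thesis
      using L2_inner_T_op_char_exp[OF hyps p] \<xi> by simp
  qed
  ultimately show ?thesis
    using T S_op_char_exp_dense[OF hyps]
    by (auto simp: spectral_with_def orthonormal_basis_L2_def)
qed

end
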